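(* Let $k\in\{1,\dots,p\}$. Let $M$ be a $p\times p$ real matrix (not necessarily symmetric) that is $k$-sparse, in the sense that all of its rows and columns are $k$-sparse (each has at most $k$ nonzero entries). Let $r=\mathsf{sr}(M)$ be its stable rank. Then there exist $I,J\subset\{1,\dots,p\}$ such that $$\|M_{IJ}\|_2\ge\frac18\|M\|_2,\qquad |I|\le C k r,\qquad |J|\le C k r\log r,$$ where $C$ is an absolute constant.
   Context: $\|\cdot\|_2$ denotes the spectral norm (largest singular value) and $\|\cdot\|_{\mathrm F}$ the Frobenius norm. The stable rank (also known as numerical rank) of a matrix $M$ is $\mathsf{sr}(M)=\|M\|_{\mathrm F}^2/\|M\|_2^2$, which is always a lower bound on $\mathrm{rank}(M)$. For index sets $I,J\subset\{1,\dots,p\}$, $M_{IJ}=(M_{ij})_{i\in I,j\in J}$ is the corresponding submatrix, and $|I|$ denotes the cardinality of $I$.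
   Formalization: The factor log r in the bound on |J| is read as ln(max(2, r)), since the literal claim fails near r = 1 (for p = k = 1, M = (1) it forces J to be empty); for the zero matrix, whose stable rank is undefined, r is taken to be 0. *)

theory Defs
  imports
    "HOL-Analysis.Analysis"
    "Jordan_Normal_Form.Char_Poly"
    "Jordan_Normal_Form.DL_Submatrix"
begin

(* For a matrix with more columns than rows, the spectrum of transpose A * A also contains the
   value 0, even when 0 is not among the min (dim_row A) (dim_col A) singular values of the usual
   convention.  This does not affect the largest one. *)
definition singular_values :: "real mat \<Rightarrow> real set" where
  "singular_values A = {s. 0 \<le> s \<and> eigenvalue (transpose_mat A * A) (s\<^sup>2)}"

lemma finite_singular_values: "finite (singular_values A)"
proof -
  let ?B = "transpose_mat A * A"
  have B: "?B \<in> carrier_mat (dim_col A) (dim_col A)" by auto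
  have "char_poly ?B \<noteq> 0"
    using degree_monic_char_poly[OF B] by auto
  then have "finite {x. poly (char_poly ?B) x = 0}"
    by (rule poly_roots_finite)
  moreover have "(\<lambda>s. s\<^sup>2) ` singular_values A \<subseteq> {x. poly (char_poly ?B) x = 0}"
    using eigenvalue_root_char_poly[OF B] by (auto simp: singular_values_def)
  ultimately have "finite ((\<lambda>s. s\<^sup>2) ` singular_values A)"
    using finite_subset by blast
  moreover have "inj_on (\<lambda>s. s\<^sup>2) (singular_values A)"
    by (auto simp: inj_on_def singular_values_def power2_eq_iff_nonneg)
  ultimately show ?thesis
    using finite_imageD by blast
qed

(* A matrix without columns has no singular values; inserting 0 gives it norm 0.  For every other
   matrix the set is nonempty and consists of nonnegative numbers, so 0 is harmless. *)
definition spectral_norm :: "real mat \<Rightarrow> real" where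
  "spectral_norm A = Max (insert 0 (singular_values A))"

definition frobenius_norm :: "real mat \<Rightarrow> real" where
  "frobenius_norm A = sqrt (\<Sum>i<dim_row A. \<Sum>j<dim_col A. (A $$ (i, j))\<^sup>2)"

(* The value for the zero matrix is 0 / 0 = 0. *)
definition stable_rank :: "real mat \<Rightarrow> real" where
  "stable_rank A = (frobenius_norm A)\<^sup>2 / (spectral_norm A)\<^sup>2"

definition sparse_vec :: "nat \<Rightarrow> real vec \<Rightarrow> bool" where
  "sparse_vec k v \<longleftrightarrow> card {i. i < dim_vec v \<and> v $ i \<noteq> 0} \<le> k"

definition sparse_mat :: "nat \<Rightarrow> real mat \<Rightarrow> bool" where
  "sparse_mat k A \<longleftrightarrow>
    (\<forall>i<dim_row A. sparse_vec k (row A i)) \<and> (\<forall>j<dim_col A. sparse_vec k (col A j))"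

(* The factor log r in the size bounds.  It equals ln r for r >= 2.  The stable rank of a nonzero
   matrix is at least 1, and the literal ln r vanishes at r = 1: for the matrix with a single
   nonzero entry a bound C * k * r * ln r would force an empty index set and hence a zero
   submatrix.  So for r < 2 the factor is read as the constant ln 2. *)
definition log_factor :: "real \<Rightarrow> real" where
  "log_factor r = ln (max 2 r)"

end

theory Submission
  imports Defs
begin

text \<open>
  For nonzero \<open>M\<close>, write \<open>s\<close> for its spectral norm, \<open>r\<close> for its stable rank, and let \<open>x\<close> be a unit vector
  with \<open>\<parallel>M x\<parallel> = s\<close>.  Call the \<open>i\<close>-th row \<open>m\<^sub>i\<close> useful if \<open>\<langle>m\<^sub>i, x\<rangle>\<^sup>2 > \<parallel>m\<^sub>i\<parallel>\<^sup>2 / (2 r)\<close>.  The squared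
  row norms add up to \<open>r s\<^sup>2\<close>, so the other rows carry at most \<open>s\<^sup>2 / 2\<close> of \<open>\<parallel>M x\<parallel>\<^sup>2 = s\<^sup>2\<close>, and the
  useful rows carry at least half.  On the other hand \<open>\<langle>m\<^sub>i, x\<rangle>\<close> sees only the part of \<open>x\<close> on the
  support of \<open>m\<^sub>i\<close>; by Cauchy-Schwarz this part has squared norm more than \<open>1 / (2 r)\<close> if the row is
  useful.  Every coordinate of \<open>x\<close> lies in at most \<open>k\<close> row supports, because the columns are
  \<open>k\<close>-sparse, so these squared norms add up to at most \<open>k\<close>, and at most \<open>2 k r\<close> rows are useful.
  This is lemma \<open>select_rows\<close>.

  Let \<open>I\<close> be the set of useful rows.  The transpose of the row-restricted matrix stretches the vector
  \<open>y = (M x)\<^sub>I\<close> by a squared factor of at least \<open>s\<^sup>2 / 2\<close> (lemma \<open>transpose_stretches\<close>), while its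
  squared Frobenius norm is still at most \<open>r s\<^sup>2 = 2 r \<cdot> s\<^sup>2 / 2\<close>.  The same selection, applied to
  this transpose with \<open>2 r\<close> in place of \<open>r\<close>, yields a set \<open>J\<close> of at most \<open>4 k r\<close> columns and loses
  another factor 2, so \<open>\<parallel>M\<^sub>I\<^sub>J\<parallel> \<ge> s / 2\<close>.  The logarithmic factor is at least \<open>ln 2 \<ge> 1 / 2\<close>, hence
  both cardinality bounds hold with \<open>C = 8\<close>.

  The selection works with plain sums.  The link to the spectral norm, which is defined by the
  eigenvalues of \<open>A\<^sup>T A\<close>, is the variational description of the largest singular value:
  \<open>spectral_norm_attained\<close> supplies \<open>x\<close>, and \<open>spectral_norm_geI\<close> bounds the norm of the submatrix
  from below by the stretching of a single vector.
\<close>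

section \<open>The largest singular value as an operator norm\<close>

text \<open>
  Vectors are functions that vanish outside of a finite index set, so that the dimension can vary.
  The unit sphere is then a closed subset of a product of compact intervals.
\<close>

lemma compact_coordinate_sphere:
  fixes J :: "'b set"
  assumes "finite J"
  shows "compact {f :: 'b \<Rightarrow> real. (\<forall>j. j \<notin> J \<longrightarrow> f j = 0) \<and> (\<Sum>j\<in>J. (f j)\<^sup>2) = 1}"
    (is "compact ?S")
proof -
  define B where "B = (\<Pi>\<^sub>E j\<in>UNIV. if j \<in> J then {-1..1::real} else {0})"
  have "compactin (product_topology (\<lambda>_. euclidean) UNIV) B"
    unfolding B_def compactin_PiE by auto
  then have B: "compact B"
    by (simp add: euclidean_product_topology)
  have closed: "closed {f :: 'b \<Rightarrow> real. (\<Sum>j\<in>J. (f j)\<^sup>2) = 1}"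
    by (intro closed_Collect_eq continuous_intros continuous_on_product_coordinates)
  have "\<bar>f j\<bar> \<le> 1" if "(\<Sum>j\<in>J. (f j)\<^sup>2) = 1" "j \<in> J" for f :: "'b \<Rightarrow> real" and j
    using member_le_sum[of j J "\<lambda>j. (f j)\<^sup>2"] that assms by (simp add: abs_square_le_1)
  then have "?S = B \<inter> {f. (\<Sum>j\<in>J. (f j)\<^sup>2) = 1}"
    by (auto simp: B_def PiE_def Pi_def abs_le_iff split: if_splits; force)
  then show ?thesis
    using B closed by (simp add: compact_Int_closed)
qed

text \<open>
  A parabola through the origin that stays nonnegative has its minimum there.
\<close>

lemma linear_coeff_zero_if_nonneg:
  fixes b c :: real
  assumes nonneg: "\<And>t. 0 \<le> 2 * t * b + t\<^sup>2 * c" and "0 \<le> c"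
  shows "b = 0"
proof (rule ccontr)
  assume "b \<noteq> 0"
  \<comment> \<open>The vertex lies at \<open>- b / c\<close>; the denominator \<open>1 + c\<close> serves \<open>c = 0\<close> as well.\<close>
  have "2 * (- b / (1 + c)) * b + (- b / (1 + c))\<^sup>2 * c = - (b\<^sup>2 * (2 + c)) / (1 + c)\<^sup>2"
    using \<open>0 \<le> c\<close> by (simp add: divide_simps power2_eq_square) (simp add: algebra_simps)
  also have "\<dots> < 0"
    using \<open>b \<noteq> 0\<close> \<open>0 \<le> c\<close> by (simp add: divide_neg_pos)
  finally show False
    using nonneg[of "- b / (1 + c)"] by simp
qed

text \<open>
  A maximiser \<open>f\<close> of \<open>\<parallel>A f\<parallel>\<^sup>2\<close> on the unit sphere exists by compactness.  With \<open>s\<close> the maximum, the form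
  \<open>s \<parallel>h\<parallel>\<^sup>2 - \<parallel>A h\<parallel>\<^sup>2\<close> is nonnegative by scaling and vanishes at \<open>f\<close>, so it is stationary there, which
  says that \<open>A\<^sup>T A f = s f\<close>.
\<close>

lemma top_singular_direction:
  fixes a :: "'a \<Rightarrow> 'b \<Rightarrow> real"
  assumes J: "finite J" "J \<noteq> {}"
  obtains f s where "(\<Sum>j\<in>J. (f j)\<^sup>2) = 1"
    and "\<And>h. (\<Sum>i\<in>I. (\<Sum>j\<in>J. a i j * h j)\<^sup>2) \<le> s * (\<Sum>j\<in>J. (h j)\<^sup>2)"
    and "\<And>j. j \<in> J \<Longrightarrow> (\<Sum>i\<in>I. a i j * (\<Sum>l\<in>J. a i l * f l)) = s * f j"
proof -
  define S where "S = {f :: 'b \<Rightarrow> real. (\<forall>j. j \<notin> J \<longrightarrow> f j = 0) \<and> (\<Sum>j\<in>J. (f j)\<^sup>2) = 1}"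
  define A where "A f i = (\<Sum>j\<in>J. a i j * f j)" for f i
  have A_lin: "A (\<lambda>j. f j + t * h j) i = A f i + t * A h i" for f h t i
    by (simp add: A_def algebra_simps sum.distrib sum_distrib_left)
  define q where "q f = (\<Sum>i\<in>I. (A f i)\<^sup>2)" for f
  obtain j0 where "j0 \<in> J" using J by auto
  then have "(\<lambda>j. if j = j0 then 1 else 0) \<in> S"
    using J by (auto simp: S_def if_distrib[of "\<lambda>x. x\<^sup>2"] cong: if_cong)
  moreover have "continuous_on S q"
    unfolding q_def A_def
    by (intro continuous_intros continuous_on_subset[OF continuous_on_product_coordinates]) auto
  moreover have "compact S"
    unfolding S_def by (rule compact_coordinate_sphere[OF J(1)])
  ultimately obtain f where f: "f \<in> S" and max: "\<And>g. g \<in> S \<Longrightarrow> q g \<le> q f"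
    using continuous_attains_sup[of S q] by blast
  have f1: "(\<Sum>j\<in>J. (f j)\<^sup>2) = 1" using f by (simp add: S_def)
  have bound: "q h \<le> q f * (\<Sum>j\<in>J. (h j)\<^sup>2)" for h
  proof (cases "(\<Sum>j\<in>J. (h j)\<^sup>2) = 0")
    case True
    then have "h j = 0" if "j \<in> J" for j
      using J that by (simp add: sum_nonneg_eq_0_iff)
    then show ?thesis by (simp add: q_def A_def)
  next
    case False
    define c where "c = sqrt (\<Sum>j\<in>J. (h j)\<^sup>2)"
    have c2: "c\<^sup>2 = (\<Sum>j\<in>J. (h j)\<^sup>2)" by (simp add: c_def sum_nonneg)
    define g where "g j = (if j \<in> J then h j / c else 0)" for j
    have "(\<Sum>j\<in>J. (g j)\<^sup>2) = (\<Sum>j\<in>J. (h j)\<^sup>2) / c\<^sup>2"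
      by (simp add: g_def power_divide sum_divide_distrib)
    then have "g \<in> S" using False c2 by (simp add: S_def g_def)
    have "A g i = A h i / c" for i
      by (simp add: A_def g_def sum_divide_distrib)
    then have "q g = q h / c\<^sup>2"
      by (simp add: q_def power_divide sum_divide_distrib)
    then have "q h = q g * (\<Sum>j\<in>J. (h j)\<^sup>2)"
      using False c2 by simp
    then show ?thesis
      using max[OF \<open>g \<in> S\<close>] by (simp add: mult_right_mono sum_nonneg)
  qed
  have stationary: "q f * (\<Sum>j\<in>J. f j * h j) = (\<Sum>i\<in>I. A f i * A h i)" for h
  proof -
    \<comment> \<open>\<open>2 t ?b + t\<^sup>2 ?c\<close> is how much \<open>q\<close> falls short of its bound at \<open>f + t h\<close>.\<close>
    let ?b = "q f * (\<Sum>j\<in>J. f j * h j) - (\<Sum>i\<in>I. A f i * A h i)"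
    let ?c = "q f * (\<Sum>j\<in>J. (h j)\<^sup>2) - q h"
    have "0 \<le> 2 * t * ?b + t\<^sup>2 * ?c" for t
    proof -
      have "(\<Sum>j\<in>J. (f j + t * h j)\<^sup>2)
          = 1 + 2 * t * (\<Sum>j\<in>J. f j * h j) + t\<^sup>2 * (\<Sum>j\<in>J. (h j)\<^sup>2)"
        unfolding f1[symmetric]
        by (simp add: power2_sum power_mult_distrib sum.distrib sum_distrib_left algebra_simps)
      moreover have "q (\<lambda>j. f j + t * h j)
          = q f + 2 * t * (\<Sum>i\<in>I. A f i * A h i) + t\<^sup>2 * q h"
        by (simp add: q_def A_lin power2_sum power_mult_distrib sum.distrib sum_distrib_left
            algebra_simps)
      ultimately show ?thesis
        using bound[of "\<lambda>j. f j + t * h j"] by (simp add: algebra_simps)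
    qed
    then have "?b = 0"
      by (rule linear_coeff_zero_if_nonneg) (simp add: bound)
    then show ?thesis by simp
  qed
  have "(\<Sum>i\<in>I. a i j * A f i) = q f * f j" if "j \<in> J" for j
  proof -
    have "(\<Sum>l\<in>J. f l * (if l = j then 1 else 0)) = f j"
      and "A (\<lambda>l. if l = j then 1 else 0) i = a i j" for i
      using that J by (simp_all add: A_def if_distrib cong: if_cong)
    then show ?thesis
      using stationary[of "\<lambda>l. if l = j then 1 else 0"] by (simp add: mult.commute)
  qed
  then show thesis
    using that[OF f1, of "q f"] bound by (simp add: q_def A_def)
qed

lemma gram_mult_index:
  fixes A :: "real mat"
  assumes "v \<in> carrier_vec (dim_col A)" "j < dim_col A"
  shows "((transpose_mat A * A) *\<^sub>v v) $ j
    = (\<Sum>i<dim_row A. A $$ (i, j) * (\<Sum>l<dim_col A. A $$ (i, l) * v $ l))"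
proof -
  have "(transpose_mat A * A) *\<^sub>v v = transpose_mat A *\<^sub>v (A *\<^sub>v v)"
    using assms by (intro assoc_mult_mat_vec[of _ "dim_col A" "dim_row A" _ "dim_col A"]) auto
  then show ?thesis
    using assms by (auto simp: scalar_prod_def lessThan_atLeast0 intro!: sum.cong)
qed

lemma spectral_norm_nonneg: "0 \<le> spectral_norm A"
  unfolding spectral_norm_def by (rule Max_ge) (auto simp: finite_singular_values)

text \<open>
  The largest stretching factor is itself a singular value, so the stretching of any vector is a lower
  bound for the norm.
\<close>

lemma spectral_norm_geI:
  assumes x: "0 < (\<Sum>j<dim_col A. (x j)\<^sup>2)"
    and le: "t\<^sup>2 * (\<Sum>j<dim_col A. (x j)\<^sup>2)
      \<le> (\<Sum>i<dim_row A. (\<Sum>j<dim_col A. A $$ (i, j) * x j)\<^sup>2)"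
  shows "t \<le> spectral_norm A"
proof -
  let ?J = "{..<dim_col A}"
  have "finite ?J" "?J \<noteq> {}" using x by (auto simp: lessThan_eq_iff intro: ccontr)
  then obtain f s where f1: "(\<Sum>j\<in>?J. (f j)\<^sup>2) = 1"
    and bound: "\<And>h. (\<Sum>i<dim_row A. (\<Sum>j\<in>?J. A $$ (i, j) * h j)\<^sup>2) \<le> s * (\<Sum>j\<in>?J. (h j)\<^sup>2)"
    and eigen: "\<And>j. j \<in> ?J \<Longrightarrow>
      (\<Sum>i<dim_row A. A $$ (i, j) * (\<Sum>l\<in>?J. A $$ (i, l) * f l)) = s * f j"
    by (rule top_singular_direction[of ?J "\<lambda>i j. A $$ (i, j)" "{..<dim_row A}"]) (rule that)
  have "0 \<le> s" using order_trans[OF sum_nonneg bound[of f]] f1 by simp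
  let ?v = "vec (dim_col A) f"
  have "?v \<noteq> 0\<^sub>v (dim_col A)"
  proof
    assume *: "?v = 0\<^sub>v (dim_col A)"
    have "f j = 0" if "j \<in> ?J" for j
      using arg_cong[OF *, of "\<lambda>w. w $ j"] that by simp
    then show False using f1 by simp
  qed
  moreover have "(transpose_mat A * A) *\<^sub>v ?v = s \<cdot>\<^sub>v ?v"
    by (rule eq_vecI) (simp_all add: gram_mult_index eigen del: index_mult_mat_vec)
  ultimately have "eigenvector (transpose_mat A * A) ?v s"
    by (simp add: eigenvector_def)
  then have "sqrt s \<in> singular_values A"
    using \<open>0 \<le> s\<close> by (auto simp: singular_values_def eigenvalue_def)
  then have "sqrt s \<le> spectral_norm A"
    unfolding spectral_norm_def by (intro Max_ge) (simp_all add: finite_singular_values)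
  moreover have "t\<^sup>2 \<le> s"
    using order_trans[OF le bound] x by simp
  then have "t \<le> sqrt s" by (rule real_le_rsqrt)
  ultimately show ?thesis by simp
qed

lemma spectral_norm_attained:
  assumes "0 < spectral_norm A"
  obtains x where "0 < (\<Sum>j<dim_col A. (x j)\<^sup>2)"
    and "(\<Sum>i<dim_row A. (\<Sum>j<dim_col A. A $$ (i, j) * x j)\<^sup>2)
      = (spectral_norm A)\<^sup>2 * (\<Sum>j<dim_col A. (x j)\<^sup>2)"
proof -
  let ?s = "spectral_norm A" and ?n = "dim_col A"
  have "?s \<in> insert 0 (singular_values A)"
    unfolding spectral_norm_def by (rule Max_in) (simp_all add: finite_singular_values)
  then obtain v where v: "v \<in> carrier_vec ?n" "v \<noteq> 0\<^sub>v ?n"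
    and eigen: "(transpose_mat A * A) *\<^sub>v v = ?s\<^sup>2 \<cdot>\<^sub>v v"
    using assms by (auto simp: singular_values_def eigenvalue_def eigenvector_def)
  define x where "x j = v $ j" for j
  define y where "y i = (\<Sum>l<?n. A $$ (i, l) * x l)" for i
  have eig: "(\<Sum>i<dim_row A. A $$ (i, j) * y i) = ?s\<^sup>2 * x j" if "j < ?n" for j
    using gram_mult_index[OF v(1) that] v(1) that unfolding eigen by (simp add: x_def y_def)
  have "(\<Sum>i<dim_row A. (y i)\<^sup>2) = (\<Sum>i<dim_row A. \<Sum>j<?n. A $$ (i, j) * x j * y i)"
    unfolding power2_eq_square by (subst (1) y_def) (simp add: sum_distrib_right)
  also have "\<dots> = (\<Sum>j<?n. x j * (\<Sum>i<dim_row A. A $$ (i, j) * y i))"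
    by (subst sum.swap) (simp add: sum_distrib_left mult_ac)
  also have "\<dots> = ?s\<^sup>2 * (\<Sum>j<?n. (x j)\<^sup>2)"
    unfolding sum_distrib_left[of "?s\<^sup>2"]
  proof (rule sum.cong)
    fix j assume "j \<in> {..<?n}"
    then show "x j * (\<Sum>i<dim_row A. A $$ (i, j) * y i) = ?s\<^sup>2 * (x j)\<^sup>2"
      using eig[of j] by (simp only: lessThan_iff power2_eq_square[of "x j"] mult_ac)
  qed simp
  finally have "(\<Sum>i<dim_row A. (y i)\<^sup>2) = ?s\<^sup>2 * (\<Sum>j<?n. (x j)\<^sup>2)" .
  moreover obtain j where "j < ?n" "x j \<noteq> 0"
    using v by (metis x_def carrier_vecD eq_vecI index_zero_vec)
  then have "0 < (\<Sum>j<?n. (x j)\<^sup>2)"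
    by (intro sum_pos2[of _ j]) auto
  ultimately show thesis using that by (simp add: y_def)
qed

lemma pick_bij_betw:
  assumes "finite I"
  shows "bij_betw (pick I) {..<card I} I"
proof -
  have inj: "inj_on (pick I) {..<card I}"
    unfolding inj_on_def by (metis lessThan_iff nat_neq_iff pick_mono_le)
  moreover have "pick I ` {..<card I} \<subseteq> I"
    using pick_in_set_le by auto
  ultimately show ?thesis
    using assms by (simp add: bij_betw_def card_image card_subset_eq)
qed

text \<open>
  A submatrix renumbers the selected rows and columns by \<^const>\<open>pick\<close>; undoing this renumbering in the
  sums allows the test vector to keep the indices of the large matrix.
\<close>

lemma spectral_norm_submatrix_geI:
  assumes I: "I \<subseteq> {0..<dim_row A}" and J: "J \<subseteq> {0..<dim_col A}"
    and x: "0 < (\<Sum>j\<in>J. (x j)\<^sup>2)"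
    and le: "t\<^sup>2 * (\<Sum>j\<in>J. (x j)\<^sup>2) \<le> (\<Sum>i\<in>I. (\<Sum>j\<in>J. A $$ (i, j) * x j)\<^sup>2)"
  shows "t \<le> spectral_norm (submatrix A I J)"
proof -
  have fin: "finite I" "finite J" using I J by (auto intro: finite_subset)
  have rows: "{i. i < dim_row A \<and> i \<in> I} = I" and cols: "{j. j < dim_col A \<and> j \<in> J} = J"
    using I J by auto
  note dims = dim_submatrix[of A I J, unfolded rows cols]
  note sum_I = sum.reindex_bij_betw[OF pick_bij_betw[OF fin(1)], symmetric]
  note sum_J = sum.reindex_bij_betw[OF pick_bij_betw[OF fin(2)], symmetric]
  note index = submatrix_index[of _ A I _ J, unfolded rows cols]
  show ?thesis
    by (rule spectral_norm_geI[where x = "\<lambda>j. x (pick J j)"])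
      (use x le in \<open>simp_all add: dims index sum_I sum_J\<close>)
qed

section \<open>Selecting rows and columns\<close>

text \<open>
  With \<open>y = A x\<close>, the identity \<open>\<parallel>y\<parallel>\<^sup>2 = \<langle>x, A\<^sup>T y\<rangle>\<close> and Cauchy-Schwarz give \<open>\<parallel>A\<^sup>T y\<parallel> \<ge> \<parallel>y\<parallel>\<^sup>2 / \<parallel>x\<parallel>\<close>.  A lower
  bound for the stretching of one vector thus passes from a matrix to its
  transpose.
\<close>

lemma transpose_stretches:
  fixes a :: "'a \<Rightarrow> 'b \<Rightarrow> real" and x :: "'b \<Rightarrow> real" and I :: "'a set" and J :: "'b set"
  defines "y \<equiv> \<lambda>i. \<Sum>j\<in>J. a i j * x j"
  assumes x: "0 < (\<Sum>j\<in>J. (x j)\<^sup>2)"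
    and le: "t * (\<Sum>j\<in>J. (x j)\<^sup>2) \<le> (\<Sum>i\<in>I. (y i)\<^sup>2)"
  shows "t * (\<Sum>i\<in>I. (y i)\<^sup>2) \<le> (\<Sum>j\<in>J. (\<Sum>i\<in>I. a i j * y i)\<^sup>2)"
proof -
  let ?X = "\<Sum>j\<in>J. (x j)\<^sup>2" and ?Y = "\<Sum>i\<in>I. (y i)\<^sup>2"
  define z where "z j = (\<Sum>i\<in>I. a i j * y i)" for j
  have "?Y = (\<Sum>i\<in>I. \<Sum>j\<in>J. a i j * x j * y i)"
    unfolding power2_eq_square by (subst (1) y_def) (simp add: sum_distrib_right)
  also have "\<dots> = (\<Sum>j\<in>J. x j * z j)"
    unfolding z_def by (subst sum.swap) (simp add: sum_distrib_left mult_ac)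
  finally have Y: "?Y = (\<Sum>j\<in>J. x j * z j)" .
  have "?X * (t * ?Y) = (t * ?X) * ?Y" by simp
  also have "\<dots> \<le> ?Y * ?Y" using le by (intro mult_right_mono sum_nonneg) auto
  also have "\<dots> \<le> ?X * (\<Sum>j\<in>J. (z j)\<^sup>2)"
    unfolding Y power2_eq_square[symmetric] by (rule Cauchy_Schwarz_ineq_sum)
  finally have "?X * (t * ?Y) \<le> ?X * (\<Sum>j\<in>J. (z j)\<^sup>2)" .
  then show ?thesis
    using x by (simp add: z_def)
qed

text \<open>
  The selection keeps the rows on which \<open>A x\<close> is large compared with the norm of the row.  The
  Frobenius bound controls what is lost, and the sparsity of the columns controls how many rows are
  kept.  The number \<open>\<rho>\<close> is an upper bound for the stable rank, measured against the squared
  stretching factor \<open>t\<close> of \<open>x\<close> instead of the squared norm; this form also fits a restricted matrix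
  whose top singular vector is unknown.
\<close>

lemma select_rows:
  fixes a :: "'a \<Rightarrow> 'b \<Rightarrow> real" and x :: "'b \<Rightarrow> real"
  assumes fin: "finite R" "finite S"
    and sparse: "\<And>j. j \<in> S \<Longrightarrow> card {i\<in>R. a i j \<noteq> 0} \<le> k"
    and x: "0 < (\<Sum>j\<in>S. (x j)\<^sup>2)" and \<rho>: "0 < \<rho>"
    and frob: "(\<Sum>i\<in>R. \<Sum>j\<in>S. (a i j)\<^sup>2) \<le> \<rho> * t"
    and stretch: "t * (\<Sum>j\<in>S. (x j)\<^sup>2) \<le> (\<Sum>i\<in>R. (\<Sum>j\<in>S. a i j * x j)\<^sup>2)"
  obtains I where "I \<subseteq> R" "real (card I) \<le> 2 * \<rho> * real k"
    and "t / 2 * (\<Sum>j\<in>S. (x j)\<^sup>2) \<le> (\<Sum>i\<in>I. (\<Sum>j\<in>S. a i j * x j)\<^sup>2)"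
proof -
  define X where "X = (\<Sum>j\<in>S. (x j)\<^sup>2)"
  define y where "y i = (\<Sum>j\<in>S. a i j * x j)" for i
  define w where "w i = (\<Sum>j\<in>S. (a i j)\<^sup>2)" for i
  \<comment> \<open>The strict inequality excludes zero rows, whose number is not controlled.\<close>
  define I where "I = {i\<in>R. X * w i < 2 * \<rho> * (y i)\<^sup>2}"
  have "I \<subseteq> R" "finite I" using fin by (auto simp: I_def)
  have "2 * \<rho> * (\<Sum>i\<in>R-I. (y i)\<^sup>2) \<le> X * (\<Sum>i\<in>R-I. w i)"
    unfolding sum_distrib_left by (rule sum_mono) (auto simp: I_def)
  also have "\<dots> \<le> X * (\<Sum>i\<in>R. w i)"
    using x fin by (intro mult_left_mono sum_mono2) (auto simp: X_def w_def sum_nonneg)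
  also have "\<dots> \<le> X * (\<rho> * t)"
    using frob x by (intro mult_left_mono) (auto simp: X_def w_def)
  finally have "\<rho> * (2 * (\<Sum>i\<in>R-I. (y i)\<^sup>2)) \<le> \<rho> * (X * t)"
    by (simp add: mult_ac)
  then have "2 * (\<Sum>i\<in>R-I. (y i)\<^sup>2) \<le> X * t"
    using \<rho> by simp
  moreover have "(\<Sum>i\<in>R. (y i)\<^sup>2) = (\<Sum>i\<in>R-I. (y i)\<^sup>2) + (\<Sum>i\<in>I. (y i)\<^sup>2)"
    using \<open>I \<subseteq> R\<close> fin by (intro sum.subset_diff)
  ultimately have kept: "t / 2 * X \<le> (\<Sum>i\<in>I. (y i)\<^sup>2)"
    using stretch unfolding X_def[symmetric] y_def[symmetric] by (simp add: mult_ac)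
  have local_mass: "X \<le> 2 * \<rho> * (\<Sum>j\<in>{j\<in>S. a i j \<noteq> 0}. (x j)\<^sup>2)" if "i \<in> I" for i
  proof -
    let ?T = "{j\<in>S. a i j \<noteq> 0}"
    have y: "y i = (\<Sum>j\<in>?T. a i j * x j)" and w: "w i = (\<Sum>j\<in>?T. (a i j)\<^sup>2)"
      unfolding y_def w_def using fin by (auto intro!: sum.mono_neutral_right)
    have CS: "(y i)\<^sup>2 \<le> w i * (\<Sum>j\<in>?T. (x j)\<^sup>2)"
      unfolding y w by (rule Cauchy_Schwarz_ineq_sum)
    have lt: "X * w i < 2 * \<rho> * (y i)\<^sup>2" using that by (simp add: I_def)
    have "w i \<noteq> 0" using CS lt by auto
    then have "0 < w i" by (metis less_eq_real_def sum_nonneg w_def zero_le_power2)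
    have "X * w i \<le> 2 * \<rho> * (w i * (\<Sum>j\<in>?T. (x j)\<^sup>2))"
      using lt CS \<rho> by (meson less_imp_le mult_left_mono order_trans zero_le_mult_iff zero_le_numeral)
    then have "w i * X \<le> w i * (2 * \<rho> * (\<Sum>j\<in>?T. (x j)\<^sup>2))"
      by (simp add: mult_ac)
    then show ?thesis using \<open>0 < w i\<close> by simp
  qed
  have "real (card I) * X \<le> (\<Sum>i\<in>I. 2 * \<rho> * (\<Sum>j\<in>{j\<in>S. a i j \<noteq> 0}. (x j)\<^sup>2))"
    using sum_mono[OF local_mass, of I "\<lambda>i. i"] by simp
  \<comment> \<open>Double counting: a coordinate of \<open>x\<close> is charged once for each selected row that meets it.\<close>
  also have "\<dots> = 2 * \<rho> * (\<Sum>j\<in>S. \<Sum>i\<in>{i\<in>I. a i j \<noteq> 0}. (x j)\<^sup>2)"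
    unfolding sum_distrib_left using fin \<open>finite I\<close> by (subst sum.swap_restrict) auto
  also have "\<dots> \<le> 2 * \<rho> * (\<Sum>j\<in>S. real k * (x j)\<^sup>2)"
  proof (intro mult_left_mono sum_mono)
    fix j assume "j \<in> S"
    have "card {i\<in>I. a i j \<noteq> 0} \<le> card {i\<in>R. a i j \<noteq> 0}"
      using \<open>I \<subseteq> R\<close> fin by (intro card_mono) auto
    then show "(\<Sum>i\<in>{i\<in>I. a i j \<noteq> 0}. (x j)\<^sup>2) \<le> real k * (x j)\<^sup>2"
      using sparse[OF \<open>j \<in> S\<close>] by (simp add: mult_right_mono)
  qed (use \<rho> in simp)
  also have "\<dots> = (2 * \<rho> * real k) * X"
    by (simp add: X_def sum_distrib_left mult_ac)
  finally have "real (card I) \<le> 2 * \<rho> * real k"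
    using x by (simp add: X_def)
  then show thesis
    using that \<open>I \<subseteq> R\<close> kept by (simp add: X_def y_def)
qed

lemma card_nonzero_sparse:
  assumes "sparse_mat k M"
  shows "i < dim_row M \<Longrightarrow> card {j\<in>{..<dim_col M}. M $$ (i, j) \<noteq> 0} \<le> k"
    and "j < dim_col M \<Longrightarrow> card {i\<in>{..<dim_row M}. M $$ (i, j) \<noteq> 0} \<le> k"
proof -
  assume i: "i < dim_row M"
  then have "{j\<in>{..<dim_col M}. M $$ (i, j) \<noteq> 0} = {j. j < dim_vec (row M i) \<and> row M i $ j \<noteq> 0}"
    by auto
  then show "card {j\<in>{..<dim_col M}. M $$ (i, j) \<noteq> 0} \<le> k"
    using assms i by (simp only: sparse_mat_def sparse_vec_def)
next
  assume j: "j < dim_col M"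
  then have "{i\<in>{..<dim_row M}. M $$ (i, j) \<noteq> 0} = {i. i < dim_vec (col M j) \<and> col M j $ i \<noteq> 0}"
    by auto
  then show "card {i\<in>{..<dim_row M}. M $$ (i, j) \<noteq> 0} \<le> k"
    using assms j by (simp only: sparse_mat_def sparse_vec_def)
qed

text \<open>
  Selection of rows for the top singular vector, then selection of columns for the image vector.  Each
  selection halves the squared stretching factor, hence the norm drops to no less than one half; the
  first loss doubles the stable rank that the second selection sees.
\<close>

lemma sparse_mat_large_submatrix:
  assumes sparse: "sparse_mat k M"
  obtains I J where "I \<subseteq> {0..<dim_row M}" "J \<subseteq> {0..<dim_col M}"
    and "spectral_norm M / 2 \<le> spectral_norm (submatrix M I J)"
    and "real (card I) \<le> 2 * stable_rank M * real k"
    and "real (card J) \<le> 4 * stable_rank M * real k"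
proof (cases "spectral_norm M = 0")
  case True
  then show thesis
    using that[of "{}" "{}"] by (simp add: spectral_norm_nonneg stable_rank_def)
next
  case False
  define s where "s = spectral_norm M"
  define r where "r = stable_rank M"
  let ?R = "{0..<dim_row M}" and ?S = "{0..<dim_col M}"
  let ?a = "\<lambda>i j. M $$ (i, j)"
  have s: "0 < s"
    using False spectral_norm_nonneg[of M] by (simp add: s_def)
  obtain x where x: "0 < (\<Sum>j\<in>?S. (x j)\<^sup>2)"
    and top: "(\<Sum>i\<in>?R. (\<Sum>j\<in>?S. ?a i j * x j)\<^sup>2) = s\<^sup>2 * (\<Sum>j\<in>?S. (x j)\<^sup>2)"
    using spectral_norm_attained[of M] s unfolding s_def lessThan_atLeast0 by blast
  have "(\<Sum>i\<in>?R. \<Sum>j\<in>?S. (?a i j)\<^sup>2) = (frobenius_norm M)\<^sup>2"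
    by (simp add: frobenius_norm_def sum_nonneg lessThan_atLeast0)
  then have frob: "(\<Sum>i\<in>?R. \<Sum>j\<in>?S. (?a i j)\<^sup>2) = r * s\<^sup>2"
    using s by (simp add: r_def stable_rank_def s_def)
  have r: "0 < r"
  proof (rule ccontr)
    assume "\<not> 0 < r"
    then have "r * s\<^sup>2 \<le> 0" by (simp add: mult_nonpos_nonneg)
    then have "(\<Sum>i\<in>?R. \<Sum>j\<in>?S. (?a i j)\<^sup>2) = 0"
      unfolding frob[symmetric] by (intro antisym sum_nonneg) auto
    then have "?a i j = 0" if "i \<in> ?R" "j \<in> ?S" for i j
      using that by (simp add: sum_nonneg_eq_0_iff sum_nonneg)
    then have "(\<Sum>i\<in>?R. (\<Sum>j\<in>?S. ?a i j * x j)\<^sup>2) = 0" by simp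
    then show False using top x s by simp
  qed
  obtain I where I: "I \<subseteq> ?R" "real (card I) \<le> 2 * r * real k"
    and I_le: "s\<^sup>2 / 2 * (\<Sum>j\<in>?S. (x j)\<^sup>2) \<le> (\<Sum>i\<in>I. (\<Sum>j\<in>?S. ?a i j * x j)\<^sup>2)"
    by (rule select_rows[where R = ?R and S = ?S and a = ?a and x = x and \<rho> = r and k = k
          and t = "s\<^sup>2"])
      (use card_nonzero_sparse(2)[OF sparse] x r frob top in \<open>auto simp: lessThan_atLeast0\<close>)
  define y where "y i = (\<Sum>j\<in>?S. ?a i j * x j)" for i
  have finI: "finite I" using I by (auto intro: finite_subset)
  have y: "0 < (\<Sum>i\<in>I. (y i)\<^sup>2)"
    using I_le x s unfolding y_def by (intro less_le_trans[OF _ I_le]) simp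
  have y_le: "s\<^sup>2 / 2 * (\<Sum>i\<in>I. (y i)\<^sup>2) \<le> (\<Sum>j\<in>?S. (\<Sum>i\<in>I. ?a i j * y i)\<^sup>2)"
    using transpose_stretches[OF x I_le] by (simp add: y_def)
  have sparse_I: "card {j\<in>?S. ?a i j \<noteq> 0} \<le> k" if "i \<in> I" for i
    using card_nonzero_sparse(1)[OF sparse, of i] that I by (auto simp: lessThan_atLeast0)
  have "(\<Sum>j\<in>?S. \<Sum>i\<in>I. (?a i j)\<^sup>2) = (\<Sum>i\<in>I. \<Sum>j\<in>?S. (?a i j)\<^sup>2)"
    by (rule sum.swap)
  also have "\<dots> \<le> r * s\<^sup>2"
    unfolding frob[symmetric] using I by (intro sum_mono2) (auto simp: sum_nonneg)
  finally have frob_I: "(\<Sum>j\<in>?S. \<Sum>i\<in>I. (?a i j)\<^sup>2) \<le> 2 * r * (s\<^sup>2 / 2)" by simp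
  obtain J where J: "J \<subseteq> ?S" "real (card J) \<le> 2 * (2 * r) * real k"
    and J_le: "s\<^sup>2 / 2 / 2 * (\<Sum>i\<in>I. (y i)\<^sup>2) \<le> (\<Sum>j\<in>J. (\<Sum>i\<in>I. ?a i j * y i)\<^sup>2)"
    by (rule select_rows[where R = ?S and S = I and a = "\<lambda>j i. ?a i j" and x = y and \<rho> = "2 * r"
          and k = k and t = "s\<^sup>2 / 2"])
      (use finI sparse_I y r frob_I y_le in auto)
  define z where "z j = (\<Sum>i\<in>I. ?a i j * y i)" for j
  have z: "0 < (\<Sum>j\<in>J. (z j)\<^sup>2)"
    using y s unfolding z_def by (intro less_le_trans[OF _ J_le]) simp
  have "(s / 2)\<^sup>2 * (\<Sum>j\<in>J. (z j)\<^sup>2) \<le> (\<Sum>i\<in>I. (\<Sum>j\<in>J. ?a i j * z j)\<^sup>2)"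
    using transpose_stretches[OF y J_le] by (simp add: z_def power_divide)
  then have "s / 2 \<le> spectral_norm (submatrix M I J)"
    using I J z by (intro spectral_norm_submatrix_geI)
  then show thesis
    using that[OF I(1) J(1)] I(2) J(2) by (simp add: s_def r_def)
qed

theorem theorem3:
  shows "\<exists>C::real. C > 0 \<and>
    (\<forall>(p::nat) (k::nat) (M::real mat).
      k \<in> {1..p} \<longrightarrow> M \<in> carrier_mat p p \<longrightarrow> sparse_mat k M \<longrightarrow>
      (\<exists>I J. I \<subseteq> {0..<p} \<and> J \<subseteq> {0..<p} \<and>
        spectral_norm (submatrix M I J) \<ge> 1 / 8 * spectral_norm M \<and>
        real (card I) \<le> C * real k * stable_rank M \<and>
        real (card J) \<le> C * real k * stable_rank M * log_factor (stable_rank M)))"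
proof (intro exI[of _ 8] conjI allI impI)
  fix p k :: nat and M :: "real mat"
  assume M: "M \<in> carrier_mat p p" and sparse: "sparse_mat k M"
  obtain I J where I: "I \<subseteq> {0..<p}" and J: "J \<subseteq> {0..<p}"
    and norm: "spectral_norm M / 2 \<le> spectral_norm (submatrix M I J)"
    and card_I: "real (card I) \<le> 2 * stable_rank M * real k"
    and card_J: "real (card J) \<le> 4 * stable_rank M * real k"
    using sparse_mat_large_submatrix[OF sparse] M by (metis carrier_matD)
  define q where "q = real k * stable_rank M"
  have "0 \<le> q" by (simp add: q_def stable_rank_def)
  have "1 / 2 \<le> ln (2 :: real)" using ln2_ge_two_thirds by simp
  also have "\<dots> \<le> log_factor (stable_rank M)" by (simp add: log_factor_def)
  finally have "q * (1 / 2) \<le> q * log_factor (stable_rank M)"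
    using \<open>0 \<le> q\<close> by (rule mult_left_mono)
  then have "real (card J) \<le> 8 * real k * stable_rank M * log_factor (stable_rank M)"
    using card_J by (simp add: q_def mult_ac)
  moreover have "real (card I) \<le> 8 * real k * stable_rank M"
    using card_I \<open>0 \<le> q\<close> by (simp add: q_def mult_ac)
  moreover have "1 / 8 * spectral_norm M \<le> spectral_norm (submatrix M I J)"
    using norm spectral_norm_nonneg[of M] by simp
  ultimately show "\<exists>I J. I \<subseteq> {0..<p} \<and> J \<subseteq> {0..<p} \<and>
      spectral_norm (submatrix M I J) \<ge> 1 / 8 * spectral_norm M \<and>
      real (card I) \<le> 8 * real k * stable_rank M \<and>
      real (card J) \<le> 8 * real k * stable_rank M * log_factor (stable_rank M)"
    using I J by blast
qed simp

end
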